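(* For every integer $n \ge 2$, $$\left\lfloor \frac{3n+4}{4}\right\rfloor \le \gamma_{MB}(P_3 \square P_n) \le \frac{4n+\sigma(n)}{3},$$ where $\sigma(n)=0$ if $3 \mid n$, $\sigma(n)=-1$ if $n\equiv 1 \pmod 3$, and $\sigma(n)=1$ if $n \equiv 2 \pmod 3$.
   Context: The Maker-Breaker domination game on a finite graph $G$ is played by Dominator and Staller, who alternately claim a previously unplayed vertex of $G$. Dominator wins as soon as his claimed vertices form a dominating set of $G$; Staller wins if she claims all vertices of some closed neighborhood $N_G[v]$. The D-game is the game where Dominator moves first. $\gamma_{MB}(G)$ is the minimum number of moves Dominator needs to win the D-game when both players play optimally (Dominator trying to win as fast as possible, Staller trying to delay this), and is $\infty$ if Dominator has no winning strategy. $P_k$ is the path on $k$ vertices and $\square$ denotes the Cartesian product of graphs. *)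

theory Defs
  imports "Graph_Theory.Pair_Digraph" "HOL-Library.Extended_Real"
begin

text \<open>
  A finite simple graph is a \<^locale>\<open>pair_graph\<close>: a finite digraph without loops or
  parallel arcs whose arc set is symmetric, so that each edge is present as two arcs.
\<close>

definition path_graph :: "nat \<Rightarrow> nat pair_pre_digraph" where
  "path_graph k =
     \<lparr> pverts = {..<k}, parcs = {(i, j). i < k \<and> j < k \<and> (j = Suc i \<or> i = Suc j)} \<rparr>"

definition cartesian_prod ::
  "'a pair_pre_digraph \<Rightarrow> 'b pair_pre_digraph \<Rightarrow> ('a \<times> 'b) pair_pre_digraph"
  (infixr "\<box>" 70) where
  "G \<box> H =
     \<lparr> pverts = pverts G \<times> pverts H,
       parcs = {((g, h), (g', h')).
                  (g = g' \<and> g \<in> pverts G \<and> (h, h') \<in> parcs H) \<or>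
                  ((g, g') \<in> parcs G \<and> h = h' \<and> h \<in> pverts H)} \<rparr>"

lemma pair_graph_path_graph: "pair_graph (path_graph k)"
proof -
  have "finite (parcs (path_graph k))"
    by (rule finite_subset[of _ "{..<k} \<times> {..<k}"]) (auto simp: path_graph_def)
  then show ?thesis
    by unfold_locales (auto simp: path_graph_def symmetric_def intro: symI)
qed

lemma pair_graph_cartesian_prod:
  assumes "pair_graph G" "pair_graph H"
  shows "pair_graph (G \<box> H)"
proof -
  interpret G: pair_graph G by fact
  interpret H: pair_graph H by fact
  have sub: "parcs (G \<box> H) \<subseteq> (pverts G \<times> pverts H) \<times> (pverts G \<times> pverts H)"
    by (auto simp: cartesian_prod_def dest: G.wellformed' H.wellformed')
  then have fin: "finite (parcs (G \<box> H))"
    by (rule finite_subset) (simp add: G.pair_finite_verts H.pair_finite_verts)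
  have "sym (parcs G)" "sym (parcs H)"
    using G.pair_sym_arcs H.pair_sym_arcs by (auto simp: symmetric_def)
  then have "sym (parcs (G \<box> H))"
    by (auto simp: cartesian_prod_def sym_def)
  moreover have "fst e \<noteq> snd e" if "e \<in> parcs (G \<box> H)" for e
    using that by (auto simp: cartesian_prod_def dest: G.pair_no_loops H.pair_no_loops)
  moreover have "pverts (G \<box> H) = pverts G \<times> pverts H"
    by (simp add: cartesian_prod_def)
  ultimately show ?thesis
    using sub fin
    by unfold_locales
      (auto simp: symmetric_def G.pair_finite_verts H.pair_finite_verts
        dest!: subsetD)
qed

definition dominating_set :: "'a pair_pre_digraph \<Rightarrow> 'a set \<Rightarrow> bool" where
  "dominating_set G D \<longleftrightarrow>
     D \<subseteq> pverts G \<and> (\<forall>v \<in> pverts G - D. \<exists>u \<in> D. (v, u) \<in> parcs G)"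

text \<open>
  A history is the list of all vertices claimed so far by either player, oldest first. A strategy
  (for either player) answers every history with a vertex that is still unplayed, as long as
  there is one; its value on other histories is irrelevant.
\<close>

definition strategies :: "'a pair_pre_digraph \<Rightarrow> ('a list \<Rightarrow> 'a) set" where
  "strategies G = {\<sigma>. \<forall>h. pverts G - set h \<noteq> {} \<longrightarrow> \<sigma> h \<in> pverts G - set h}"

text \<open>
  The history of the D-game after \<open>t\<close> moves, Dominator using \<open>\<sigma>\<close> and Staller using \<open>\<tau>\<close>.
  Play is continued until the board is full even if a player has already won. This is harmless:
  only Dominator's first moment of success is evaluated below, and he can never
  dominate once Staller has claimed a closed neighborhood.
\<close>

primrec D_game :: "'a pair_pre_digraph \<Rightarrow> ('a list \<Rightarrow> 'a) \<Rightarrow> ('a list \<Rightarrow> 'a) \<Rightarrow> nat \<Rightarrow> 'a list"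
where
  "D_game G \<sigma> \<tau> 0 = []"
| "D_game G \<sigma> \<tau> (Suc t) =
     (let h = D_game G \<sigma> \<tau> t in
      if pverts G \<subseteq> set h then h else h @ [if even t then \<sigma> h else \<tau> h])"

definition dominator_claimed :: "'a list \<Rightarrow> 'a set" where
  "dominator_claimed h = {h ! i |i. i < length h \<and> even i}"

text \<open>
  The number of Dominator's own moves until he has won; his \<open>m\<close>-th move is move number
  \<open>2 * m - 1\<close> of the game. If he never wins, this is \<open>Inf {} = \<infinity>\<close>.
\<close>

definition dominator_win_time ::
  "'a pair_pre_digraph \<Rightarrow> ('a list \<Rightarrow> 'a) \<Rightarrow> ('a list \<Rightarrow> 'a) \<Rightarrow> enat" where
  "dominator_win_time G \<sigma> \<tau> =
     Inf {enat m |m. dominating_set G (dominator_claimed (D_game G \<sigma> \<tau> (2 * m - 1)))}"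

definition gamma_MB :: "'a pair_pre_digraph \<Rightarrow> enat" where
  "gamma_MB G = (INF \<sigma> \<in> strategies G. SUP \<tau> \<in> strategies G. dominator_win_time G \<sigma> \<tau>)"

definition sigma_mod3 :: "nat \<Rightarrow> int" where
  "sigma_mod3 n = (if n mod 3 = 0 then 0 else if n mod 3 = 1 then -1 else 1)"

end

theory Submission
  imports Defs
begin

text \<open>
  Lower bound: Dominator needs at least as many moves as the size of a smallest dominating set. If
  a column contains no vertex of a dominating set, each of its three vertices is dominated
  horizontally, so the two neighbouring columns contain at least three chosen vertices together. This
  condition on the column counts alone forces \<open>4 * card D > 3 * n\<close>, by an amortised count.

  Upper bound: split the columns into blocks of three and one initial block of one, two or
  three columns. Answering Staller inside the block where she plays, Dominator dominates a
  three-column block within four moves and a two-column block within three, even if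
  Staller begins and may pass. In the initial block he spends the first move of the game; for one
  column, its centre is enough.
\<close>

section \<open>Domination number of the grid\<close>

lemma four_sum_ge_of_gaps:
  fixes c :: "nat \<Rightarrow> int"
  assumes nonneg: "\<And>j. c j \<ge> 0" and "c 0 = 0" "c (Suc n) = 0" "n \<ge> 1"
    and gap: "\<And>j. 1 \<le> j \<Longrightarrow> j \<le> n \<Longrightarrow> c j = 0 \<Longrightarrow> c (j - 1) + c (Suc j) \<ge> 3"
  shows "4 * (\<Sum>j\<le>n. c j) \<ge> 3 * int n + 1"
proof -
  \<comment> \<open>Guaranteed surplus of \<open>4 * (\<Sum>i\<le>j. c i)\<close> over
    \<open>3 * j\<close>, given the counts \<open>x\<close> and \<open>y\<close> of columns
    \<open>j - 1\<close> and \<open>j\<close>. After an empty column it may be negative, down to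
    \<open>-4\<close>: the gap condition then forces at least \<open>3 - x\<close> vertices into the
    next column, which repay the debt.\<close>
  define pot :: "int \<Rightarrow> int \<Rightarrow> int"
    where "pot x y = (if y > 0 then 2 * y - 1 else min 1 (2 * x - 4))" for x y
  have inv: "4 * (\<Sum>j\<le>Suc m. c j) \<ge> 3 * int (Suc m) + pot (c m) (c (Suc m))" if "Suc m \<le> n" for m
    using that
  proof (induction m)
    case 0
    then show ?case
      using nonneg[of 1] \<open>c 0 = 0\<close> by (auto simp: pot_def)
  next
    case (Suc m)
    have "pot (c m) (c (Suc m)) + 4 * c (Suc (Suc m)) - 3 \<ge> pot (c (Suc m)) (c (Suc (Suc m)))"
      using gap[of "Suc m"] nonneg[of m] nonneg[of "Suc m"] nonneg[of "Suc (Suc m)"] Suc.prems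
      by (auto simp: pot_def min_def)
    then show ?case
      using Suc by simp
  qed
  obtain m where m: "n = Suc m"
    using \<open>n \<ge> 1\<close> by (cases n) auto
  have "pot (c m) (c n) \<ge> 1"
    using gap[of n] nonneg[of n] \<open>c (Suc n) = 0\<close> \<open>n \<ge> 1\<close> by (auto simp: pot_def m min_def)
  then show ?thesis
    using inv[of m] by (simp add: m)
qed

abbreviation grid :: "nat \<Rightarrow> (nat \<times> nat) pair_pre_digraph" where
  "grid n \<equiv> path_graph 3 \<box> path_graph n"

lemma pverts_grid: "pverts (grid n) = {..<3} \<times> {..<n}"
  by (simp add: cartesian_prod_def path_graph_def)

lemma arc_grid_iff:
  "((i, j), (i', j')) \<in> parcs (grid n) \<longleftrightarrow>
     i < 3 \<and> i' < 3 \<and> j < n \<and> j' < n \<and>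
     (i = i' \<and> (j' = Suc j \<or> j = Suc j') \<or> j = j' \<and> (i' = Suc i \<or> i = Suc i'))"
  by (auto simp: cartesian_prod_def path_graph_def)

lemma dominating_set_grid_card:
  assumes dom: "dominating_set (grid n) D" and "n \<ge> 1"
  shows "4 * card D \<ge> 3 * n + 1"
proof -
  have D: "D \<subseteq> {..<3} \<times> {..<n}"
    using dom by (simp add: dominating_set_def pverts_grid)
  then have fin: "finite D"
    by (rule finite_subset) simp
  \<comment> \<open>Indices are shifted by one, so that the empty \<open>col 0\<close> and
    \<open>col (Suc n)\<close> bound the grid on both sides.\<close>
  define col where "col j = {v \<in> D. Suc (snd v) = j}" for j
  have fin_col: "finite (col j)" for j
    using fin by (simp add: col_def)
  have "int (card (col (j - 1))) + int (card (col (Suc j))) \<ge> 3"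
    if j: "1 \<le> j" "j \<le> n" and "int (card (col j)) = 0" for j
  proof -
    have empty: "col j = {}"
      using that fin_col by simp
    have "{..<3} \<subseteq> fst ` (col (j - 1) \<union> col (Suc j))"
    proof
      fix i :: nat
      assume "i \<in> {..<3}"
      with j have "(i, j - 1) \<in> pverts (grid n) - D"
        using empty by (force simp: pverts_grid col_def)
      then obtain i' j' where u: "(i', j') \<in> D" "((i, j - 1), (i', j')) \<in> parcs (grid n)"
        using dom unfolding dominating_set_def by fast
      have "Suc j' \<noteq> j"
        using u(1) empty by (auto simp: col_def)
      then have "i' = i" "j' = j \<or> j - 1 = Suc j'"
        using u(2) j by (auto simp: arc_grid_iff)
      then have "(i, j') \<in> col (j - 1) \<union> col (Suc j)"
        using u j by (auto simp: col_def)
      then show "i \<in> fst ` (col (j - 1) \<union> col (Suc j))"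
        by force
    qed
    then have "card {..<3::nat} \<le> card (col (j - 1) \<union> col (Suc j))"
      using fin_col by (meson card_image_le card_mono finite_UnI finite_imageI le_trans)
    also have "\<dots> \<le> card (col (j - 1)) + card (col (Suc j))"
      by (rule card_Un_le)
    finally show ?thesis
      by simp
  qed
  moreover have "col 0 = {}" "col (Suc n) = {}"
    using D by (auto simp: col_def)
  ultimately have "4 * (\<Sum>j\<le>n. int (card (col j))) \<ge> 3 * int n + 1"
    using \<open>n \<ge> 1\<close> by (intro four_sum_ge_of_gaps) auto
  moreover have "(\<Union>j\<le>n. col j) = D"
    using D by (auto simp: col_def)
  moreover have "card (\<Union>j\<le>n. col j) = (\<Sum>j\<le>n. card (col j))"
    by (rule card_UN_disjoint) (use fin_col in \<open>auto simp: col_def\<close>)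
  ultimately show ?thesis
    by (simp flip: of_nat_sum)
qed

section \<open>Generalities on the game\<close>

lemma length_D_game_le: "length (D_game G \<sigma> \<tau> t) \<le> t"
  by (induction t) (auto simp: Let_def)

lemma length_D_game:
  "\<not> pverts G \<subseteq> set (D_game G \<sigma> \<tau> t) \<Longrightarrow> length (D_game G \<sigma> \<tau> t) = t"
  by (induction t) (auto simp: Let_def split: if_splits)

lemma set_D_game_subset:
  assumes "\<sigma> \<in> strategies G" "\<tau> \<in> strategies G"
  shows "set (D_game G \<sigma> \<tau> t) \<subseteq> pverts G"
proof (induction t)
  case (Suc t)
  then show ?case
    using assms by (auto simp: Let_def strategies_def)
qed simp

lemma dominator_claimed_subset: "dominator_claimed h \<subseteq> set h"
  by (auto simp: dominator_claimed_def)

lemma card_dominator_claimed_le: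
  assumes "length h \<le> 2 * m - 1"
  shows "card (dominator_claimed h) \<le> m"
proof -
  have "dominator_claimed h \<subseteq> (\<lambda>k. h ! (2 * k)) ` {..<m}"
    using assms by (fastforce simp: dominator_claimed_def elim!: evenE)
  then have "card (dominator_claimed h) \<le> card {..<m}"
    by (meson card_image_le card_mono finite_imageI finite_lessThan le_trans)
  then show ?thesis
    by simp
qed

text \<open>Ensures that the supremum in \<open>gamma_MB\<close> is at least one actual win
  time.\<close>

lemma strategies_nonempty: "strategies G \<noteq> {}"
proof -
  have "(\<lambda>h. SOME v. v \<in> pverts G - set h) \<in> strategies G"
    unfolding strategies_def by (auto intro!: someI_ex[of "\<lambda>v. v \<in> pverts G - set _"] simp del: Diff_iff)
  then show ?thesis
    by blast
qed

text \<open>After \<open>2 * m - 1\<close> moves Dominator owns at most \<open>m\<close> vertices,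
  so he cannot have won before his move number \<open>b\<close>, whatever the strategies.\<close>

lemma gamma_MB_ge:
  assumes "\<And>D. dominating_set G D \<Longrightarrow> card D \<ge> b"
  shows "gamma_MB G \<ge> enat b"
proof -
  have "enat b \<le> dominator_win_time G \<sigma> \<tau>" for \<sigma> \<tau>
    unfolding dominator_win_time_def
  proof (rule Inf_greatest, clarify)
    fix m
    assume "dominating_set G (dominator_claimed (D_game G \<sigma> \<tau> (2 * m - 1)))"
    then show "enat b \<le> enat m"
      using assms card_dominator_claimed_le[OF length_D_game_le] by (metis enat_ord_simps(1) le_trans)
  qed
  then show ?thesis
    unfolding gamma_MB_def using strategies_nonempty[of G]
    by (intro INF_greatest) (meson SUP_upper2 ex_in_conv)
qed

section \<open>Transversal positions with Staller to move\<close>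

definition dominator_move :: "'a \<Rightarrow> 'a set set \<Rightarrow> 'a set set" where
  "dominator_move d F = {A \<in> F. d \<notin> A}"

text \<open>Taking the last free vertex of a set puts \<open>{}\<close> into the family. No later
  move removes it, so \<open>wins\<close> fails from then on.\<close>

definition staller_move :: "'a \<Rightarrow> 'a set set \<Rightarrow> 'a set set" where
  "staller_move s F = (\<lambda>A. A - {s}) ` F"

text \<open>
  A position is the family of what is still free in the sets that Dominator has yet to hit. A
  Staller vertex outside \<open>\<Union>F\<close> acts as a pass, so positions on disjoint blocks add up.
\<close>

primrec wins :: "nat \<Rightarrow> 'a set set \<Rightarrow> bool" where
  "wins 0 F \<longleftrightarrow> F = {}"
| "wins (Suc r) F \<longleftrightarrow> F = {} \<or>
     (\<forall>s. \<exists>d \<in> \<Union>(staller_move s F). wins r (dominator_move d (staller_move s F)))"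

lemma wins_empty [simp]: "wins r {}"
  by (cases r) auto

lemma move_empty [simp]: "dominator_move d {} = {}" "staller_move s {} = {}"
  by (auto simp: dominator_move_def staller_move_def)

lemma dominator_move_Un: "dominator_move d (F \<union> H) = dominator_move d F \<union> dominator_move d H"
  by (auto simp: dominator_move_def)

lemma staller_move_Un: "staller_move s (F \<union> H) = staller_move s F \<union> staller_move s H"
  by (auto simp: staller_move_def)

lemma dominator_move_id: "d \<notin> \<Union>F \<Longrightarrow> dominator_move d F = F"
  by (auto simp: dominator_move_def)

lemma staller_move_id: "s \<notin> \<Union>F \<Longrightarrow> staller_move s F = F"
proof -
  assume "s \<notin> \<Union>F"
  then have "A - {s} = A" if "A \<in> F" for A
    using that by auto
  then show ?thesis
    by (simp add: staller_move_def)
qed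

lemma Union_dominator_move: "\<Union>(dominator_move d F) \<subseteq> \<Union>F - {d}"
  by (auto simp: dominator_move_def)

lemma Union_staller_move: "\<Union>(staller_move s F) = \<Union>F - {s}"
  by (auto simp: staller_move_def)

lemma wins_mono: "wins r F \<Longrightarrow> r \<le> r' \<Longrightarrow> wins r' F"
proof (induction r arbitrary: r' F)
  case (Suc r)
  then obtain q where "r' = Suc q" "r \<le> q"
    by (cases r') auto
  then show ?case
    using Suc.prems(1) Suc.IH by (simp only: wins.simps) meson
qed simp

text \<open>Dominator replies in the component where Staller has just played, so the numbers of
  moves add up. Either bound may be the one that drops, hence the induction on
  \<open>r + q\<close>.\<close>

lemma wins_Un:
  assumes "wins r F" "wins q H" "\<Union>F \<inter> \<Union>H = {}"
  shows "wins (r + q) (F \<union> H)"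
  using assms
proof (induction "r + q" arbitrary: r q F H rule: less_induct)
  case less
  show ?case
  proof (cases "F = {} \<or> H = {}")
    case True
    then show ?thesis
      using less.prems by (auto elim!: wins_mono)
  next
    case False
    with less.prems obtain a b where ab: "r = Suc a" "q = Suc b"
      by (cases r; cases q) auto
    \<comment> \<open>Stated for arbitrary families to serve both components: it is used with
      \<open>F\<close> and \<open>H\<close> exchanged when Staller plays in \<open>H\<close>. A move
      of Staller outside both is answered in \<open>F\<close>.\<close>
    have reply: "\<exists>d \<in> \<Union>(staller_move s (F' \<union> H')).
        wins (a' + b') (dominator_move d (staller_move s (F' \<union> H')))"
      if F': "wins (Suc a') F'" "F' \<noteq> {}" and H': "wins b' H'" and disj: "\<Union>F' \<inter> \<Union>H' = {}"
        and s: "s \<notin> \<Union>H'" and less_rq: "a' + b' < r + q" for s a' b' and F' H' :: "'a set set"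
    proof -
      obtain d where d: "d \<in> \<Union>(staller_move s F')" "wins a' (dominator_move d (staller_move s F'))"
        using F' by (metis wins.simps(2))
      then have d': "d \<notin> \<Union>H'"
        using disj by (auto simp: Union_staller_move)
      have "dominator_move d (staller_move s (F' \<union> H')) = dominator_move d (staller_move s F') \<union> H'"
        by (simp only: staller_move_Un dominator_move_Un staller_move_id[OF s] dominator_move_id[OF d'])
      moreover have "\<Union>(dominator_move d (staller_move s F')) \<inter> \<Union>H' = {}"
        using disj Union_dominator_move[of d "staller_move s F'"] Union_staller_move[of s F'] by blast
      ultimately have "wins (a' + b') (dominator_move d (staller_move s (F' \<union> H')))"
        using less.hyps[OF less_rq d(2) H'] by simp
      moreover have "d \<in> \<Union>(staller_move s (F' \<union> H'))"
        using d by (simp add: staller_move_Un)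
      ultimately show ?thesis
        by blast
    qed
    have "\<exists>d \<in> \<Union>(staller_move s (F \<union> H)).
        wins (a + q) (dominator_move d (staller_move s (F \<union> H)))" for s
    proof (cases "s \<in> \<Union>H")
      case False
      show ?thesis
        by (rule reply) (use less.prems \<open>\<not> (F = {} \<or> H = {})\<close> False ab in auto)
    next
      case True
      have "\<exists>d \<in> \<Union>(staller_move s (H \<union> F)).
          wins (b + r) (dominator_move d (staller_move s (H \<union> F)))"
        by (rule reply) (use less.prems \<open>\<not> (F = {} \<or> H = {})\<close> True ab in auto)
      then show ?thesis
        by (simp add: Un_commute ab add.commute)
    qed
    then show ?thesis
      by (simp add: ab)
  qed
qed

text \<open>Staller's move is pulled back along \<open>f\<close>. A vertex outside the image is a
  pass and is pulled back to a point outside \<open>\<Union>F\<close>, which exists because the type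
  is infinite.\<close>

lemma wins_image:
  fixes f :: "'a \<Rightarrow> 'b"
  assumes "infinite (UNIV :: 'a set)"
  shows "wins r F \<Longrightarrow> finite (\<Union>F) \<Longrightarrow> inj_on f (\<Union>F) \<Longrightarrow> wins r ((`) f ` F)"
proof (induction r arbitrary: F)
  case (Suc r)
  show ?case
  proof (cases "F = {}")
    case False
    have "\<exists>d \<in> \<Union>(staller_move s ((`) f ` F)).
        wins r (dominator_move d (staller_move s ((`) f ` F)))" for s
    proof -
      obtain x where x: "\<And>y. y \<in> \<Union>F \<Longrightarrow> f y = s \<longleftrightarrow> y = x"
      proof (cases "s \<in> f ` \<Union>F")
        case True
        then obtain x where "x \<in> \<Union>F" "s = f x"
          by blast
        then show ?thesis
          using that[of x] inj_on_eq_iff[OF Suc.prems(3)] by blast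
      next
        case False
        obtain x where "x \<notin> \<Union>F"
          using ex_new_if_finite[OF assms Suc.prems(2)] by blast
        then show ?thesis
          using that False by blast
      qed
      define K where "K = staller_move x F"
      have K: "\<Union>K \<subseteq> \<Union>F"
        by (auto simp: K_def Union_staller_move)
      have "f ` A - {s} = f ` (A - {x})" if "A \<in> F" for A
        using x that by blast
      then have sK: "staller_move s ((`) f ` F) = (`) f ` K"
        unfolding K_def staller_move_def image_image by (intro image_cong) auto
      obtain d where d: "d \<in> \<Union>K" "wins r (dominator_move d K)"
        using Suc.prems(1) False unfolding K_def by (metis wins.simps(2))
      have "f d \<in> f ` A \<longleftrightarrow> d \<in> A" if "A \<in> K" for A
        by (rule inj_on_image_mem_iff[OF Suc.prems(3) subsetD[OF K d(1)]
            order_trans[OF Union_upper[OF that] K]])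
      then have dK: "dominator_move (f d) ((`) f ` K) = (`) f ` dominator_move d K"
        by (auto simp: dominator_move_def)
      have sub: "\<Union>(dominator_move d K) \<subseteq> \<Union>F"
        using Union_dominator_move[of d K] Diff_subset K by (meson order_trans)
      have "wins r ((`) f ` dominator_move d K)"
        using Suc.IH[OF d(2)] sub Suc.prems(2,3) by (meson finite_subset inj_on_subset)
      then show ?thesis
        unfolding sK using dK d(1) by (intro bexI[of _ "f d"]) auto
    qed
    then show ?thesis
      by simp
  qed simp
qed simp

text \<open>If Staller passes by playing outside \<open>\<Union>F\<close>, the first of the
  \<open>Suc r\<close> replies becomes Dominator's opening move.\<close>

lemma wins_first_move:
  assumes "wins (Suc r) F" "F \<noteq> {}" "finite (\<Union>F)" "infinite (UNIV :: 'a set)"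
  shows "\<exists>d \<in> \<Union>(F :: 'a set set). wins r (dominator_move d F)"
proof -
  obtain s where "s \<notin> \<Union>F"
    using ex_new_if_finite[OF assms(4,3)] by blast
  then show ?thesis
    using assms(1,2) staller_move_id[of s F] by (metis wins.simps(2))
qed

section \<open>From positions to strategies\<close>

fun position :: "'a set set \<Rightarrow> 'a list \<Rightarrow> 'a set set" where
  "position F [] = F"
| "position F [d] = dominator_move d F"
| "position F (d # s # h) = position (staller_move s (dominator_move d F)) h"

text \<open>\<open>position\<close> consumes a history from the front, whereas \<open>D_game\<close>
  appends at the end.\<close>

lemma position_snoc:
  "position F (h @ [x]) =
     (if even (length h) then dominator_move x (position F h) else staller_move x (position F h))"
  by (induction F h rule: position.induct) auto

text \<open>Any vertex of the remaining family is unplayed, so the replies demanded by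
  \<open>wins\<close> are legal moves.\<close>

lemma Union_position: "\<Union>(position F h) \<subseteq> \<Union>F - set h"
proof (induction F h rule: position.induct)
  case (2 F d)
  then show ?case
    using Union_dominator_move by simp
next
  case (3 F d s h)
  then show ?case
    using Union_dominator_move[of d F] by (auto simp: Union_staller_move)
qed simp

lemma dominator_claimed_Cons2:
  "dominator_claimed (d # s # h) = insert d (dominator_claimed h)"
proof -
  have "{i. i < length (d # s # h) \<and> even i} = insert 0 ((\<lambda>i. Suc (Suc i)) ` {i. i < length h \<and> even i})"
    (is "?L = ?R")
  proof
    show "?L \<subseteq> ?R"
    proof
      fix i
      assume "i \<in> ?L"
      then show "i \<in> ?R"
        by (cases i; cases "i - 1") auto
    qed
  qed auto
  then show ?thesis
    unfolding dominator_claimed_def setcompr_eq_image by (simp add: image_image)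
qed

text \<open>A set leaves the family only by being hit. Staller merely shrinks it, and whatever hits
  the rest hits the original set.\<close>

lemma position_eq_empty:
  "position F h = {} \<Longrightarrow> A \<in> F \<Longrightarrow> A \<inter> dominator_claimed h \<noteq> {}"
proof (induction F h arbitrary: A rule: position.induct)
  case (2 F d)
  then show ?case
    by (auto simp: dominator_move_def dominator_claimed_def)
next
  case (3 F d s h)
  show ?case
  proof (cases "d \<in> A")
    case False
    then have "A - {s} \<in> staller_move s (dominator_move d F)"
      using 3 by (auto simp: staller_move_def dominator_move_def)
    then show ?thesis
      using 3 by (fastforce simp: dominator_claimed_Cons2)
  qed (auto simp: dominator_claimed_Cons2)
qed simp

text \<open>Each closed neighbourhood contains a set of \<open>F\<close>, so hitting all of
  \<open>F\<close> dominates. Dominator opens with a vertex like \<open>d0\<close> and then keeps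
  \<open>wins\<close> true for \<open>r\<close> further moves.\<close>

lemma gamma_MB_le:
  assumes F: "\<Union>F \<subseteq> pverts G"
    and nbhd: "\<And>v. v \<in> pverts G \<Longrightarrow> \<exists>A \<in> F. A \<subseteq> insert v {u. (v, u) \<in> parcs G}"
    and first: "d0 \<in> \<Union>F" "wins r (dominator_move d0 F)"
  shows "gamma_MB G \<le> enat (Suc r)"
proof -
  \<comment> \<open>At Dominator's turn \<open>length h div 2\<close> of his moves are behind him;
    this many are left after the present one.\<close>
  define good where "good h d \<longleftrightarrow> d \<in> \<Union>(position F h) \<and>
    wins (r - length h div 2) (dominator_move d (position F h))" for h d
  \<comment> \<open>The second branch only keeps \<open>\<sigma>\<close> legal, for instance once
    every set has been hit.\<close>
  define \<sigma> where "\<sigma> h = (if \<exists>d. good h d then SOME d. good h d else SOME v. v \<in> pverts G - set h)" for h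
  have good_\<sigma>: "good h (\<sigma> h)" if "good h d" for h d
    using that someI[of "good h"] by (auto simp: \<sigma>_def)
  have \<sigma>: "\<sigma> \<in> strategies G"
  proof -
    have "\<sigma> h \<in> pverts G - set h" if "pverts G - set h \<noteq> {}" for h
    proof (cases "\<exists>d. good h d")
      case True
      then have "good h (\<sigma> h)"
        using good_\<sigma> by blast
      then have "\<sigma> h \<in> \<Union>(position F h)"
        by (simp only: good_def)
      then show ?thesis
        using Union_position[of F h] F by blast
    next
      case False
      then show ?thesis
        using that someI_ex[of "\<lambda>v. v \<in> pverts G - set h"] by (simp add: \<sigma>_def ex_in_conv del: Diff_iff)
    qed
    then show ?thesis
      by (simp add: strategies_def)
  qed
  have "dominator_win_time G \<sigma> \<tau> \<le> enat (Suc r)" if \<tau>: "\<tau> \<in> strategies G" for \<tau>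
  proof -
    let ?h = "D_game G \<sigma> \<tau>"
    have stays: "position F (?h (Suc t)) = {}" if "position F (?h t) = {}" for t
      using that by (simp add: Let_def position_snoc)
    have inv: "wins (r - j) (position F (?h (Suc (2 * j))))" if "j \<le> r" for j
      using that
    proof (induction j)
      case 0
      have "good [] d0"
        using first by (simp add: good_def)
      then have "good [] (\<sigma> [])"
        by (rule good_\<sigma>)
      moreover have "\<not> pverts G \<subseteq> {}"
        using F first(1) by auto
      ultimately show ?case
        by (simp add: good_def)
    next
      case (Suc j)
      define t where "t = Suc (2 * j)"
      define h where "h = ?h t"
      show ?case
      proof (cases "position F h = {}")
        case True
        then show ?thesis
          using stays[OF stays, of t] by (simp add: h_def t_def del: D_game.simps)
      next
        case False
        have "wins (Suc (r - Suc j)) (position F h)"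
          using Suc by (simp add: h_def t_def Suc_diff_Suc del: D_game.simps)
        then obtain d where d: "d \<in> \<Union>(staller_move (\<tau> h) (position F h))"
          "wins (r - Suc j) (dominator_move d (staller_move (\<tau> h) (position F h)))"
          using False by (metis wins.simps(2))
        \<comment> \<open>\<open>D_game\<close> stalls only on a full board. The free vertex
          \<open>d\<close> excludes this, which fixes the length and hence the parity of the
          history.\<close>
        then have open1: "\<not> pverts G \<subseteq> set h"
          using Union_position[of F h] F by (auto simp: Union_staller_move)
        then have len: "length h = Suc (2 * j)"
          unfolding h_def t_def by (rule length_D_game)
        define k where "k = h @ [\<tau> h]"
        have k: "position F k = staller_move (\<tau> h) (position F h)" "length k = 2 * Suc j"
          by (simp_all add: k_def position_snoc len)
        then have "good k d"
          using d by (simp add: good_def)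
        then have "good k (\<sigma> k)"
          by (rule good_\<sigma>)
        moreover have open2: "\<not> pverts G \<subseteq> set k"
          using d(1) Union_position[of F k] F by (auto simp: k)
        moreover have "odd t" "Suc (2 * Suc j) = Suc (Suc t)"
          by (simp_all add: t_def)
        then have "?h (Suc (2 * Suc j)) = k @ [\<sigma> k]"
          using open1 open2 by (simp add: Let_def k_def flip: h_def)
        ultimately show ?thesis
          by (simp add: good_def position_snoc k)
      qed
    qed
    let ?D = "dominator_claimed (?h (2 * Suc r - 1))"
    have "wins 0 (position F (?h (2 * Suc r - 1)))"
      using inv[of r] by simp
    then have hit: "A \<inter> ?D \<noteq> {}" if "A \<in> F" for A
      using position_eq_empty[of F "?h (2 * Suc r - 1)" A] that by simp
    have "?D \<subseteq> pverts G"
      using dominator_claimed_subset set_D_game_subset[OF \<sigma> \<tau>] by (rule order_trans)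
    moreover have "\<exists>u \<in> ?D. (v, u) \<in> parcs G" if "v \<in> pverts G - ?D" for v
      using nbhd[of v] hit that by blast
    ultimately have "dominating_set G ?D"
      by (simp add: dominating_set_def)
    then show ?thesis
      unfolding dominator_win_time_def by (intro Inf_lower) blast
  qed
  then show ?thesis
    unfolding gamma_MB_def using \<sigma> by (meson INF_lower2 SUP_least)
qed

section \<open>Blocks of three columns\<close>

fun shortest :: "'a list list \<Rightarrow> 'a list" where
  "shortest [] = []"
| "shortest [A] = A"
| "shortest (A # B # F) = shortest ((if length B < length A then B else A) # F)"

lemma shortest_in: "F \<noteq> [] \<Longrightarrow> shortest F \<in> set F"
  by (induction F rule: shortest.induct) (auto split: if_splits)

text \<open>Trying only replies in a smallest remaining set keeps the search small.\<close>

primrec wins_list :: "nat \<Rightarrow> 'a list list \<Rightarrow> bool" where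
  "wins_list 0 F \<longleftrightarrow> F = []"
| "wins_list (Suc r) F \<longleftrightarrow> F = [] \<or>
     (\<forall>K \<in> set (F # map (\<lambda>s. map (filter (\<lambda>x. x \<noteq> s)) F) (remdups (concat F))).
        \<exists>d \<in> set (shortest K). wins_list r (filter (\<lambda>A. d \<notin> set A) K))"

text \<open>All vertices outside the lists act alike, so the single pass \<open>F\<close> stands for
  them. Restricting Dominator to a shortest list only weakens him.\<close>

lemma wins_list_sound: "wins_list r F \<Longrightarrow> wins r (set ` set F)"
proof (induction r arbitrary: F)
  case (Suc r)
  show ?case
  proof (cases "F = []")
    case False
    have "\<exists>d \<in> \<Union>(staller_move s (set ` set F)).
        wins r (dominator_move d (staller_move s (set ` set F)))" for s
    proof -
      define K where "K = (if s \<in> set (concat F) then map (filter (\<lambda>x. x \<noteq> s)) F else F)"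
      have K: "staller_move s (set ` set F) = set ` set K"
      proof (cases "s \<in> set (concat F)")
        case True
        then show ?thesis
          by (auto simp: K_def staller_move_def image_image intro!: image_cong)
      next
        case False
        then show ?thesis
          by (simp add: K_def staller_move_id)
      qed
      have "K \<in> set (F # map (\<lambda>s. map (filter (\<lambda>x. x \<noteq> s)) F) (remdups (concat F)))"
        by (auto simp: K_def)
      then obtain d where d: "d \<in> set (shortest K)" "wins_list r (filter (\<lambda>A. d \<notin> set A) K)"
        using Suc.prems False by (metis wins_list.simps(2))
      have "K \<noteq> []"
        using False by (simp add: K_def)
      then have "d \<in> \<Union>(set ` set K)"
        using d(1) shortest_in by blast
      moreover have "dominator_move d (set ` set K) = set ` set (filter (\<lambda>A. d \<notin> set A) K)"
        by (auto simp: dominator_move_def)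
      ultimately show ?thesis
        unfolding K using Suc.IH[OF d(2)] by (intro bexI[of _ d]) simp_all
    qed
    then show ?thesis
      by simp
  qed simp
qed simp

text \<open>
  Vertex \<open>(i, j)\<close> is encoded as \<open>i + 3 * j\<close>. The order of the lists is tuned to speed up the search.
\<close>

definition nbhds_3x3 :: "nat list list" where
  "nbhds_3x3 = [[3,7,6], [2,5,1], [4,8,2,5], [0,3,1], [7,8,5], [4,2,0,1], [4,1,5,7,3],
     [6,4,0,3], [8,4,7,6]]"

lemma wins_nbhds_3x3: "wins 4 (set ` set nbhds_3x3)"
  by (rule wins_list_sound) code_simp

text \<open>A pairing strategy: the pairs are the rows of two columns, and Dominator takes the
  partner of Staller's vertex.\<close>

lemma wins_rows_3x2: "wins 3 (set ` set [[0,3], [1,4], [2,5::nat]])"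
  by (rule wins_list_sound) code_simp

section \<open>Copies of small boards inside the grid\<close>

definition cell :: "nat \<Rightarrow> nat \<Rightarrow> nat \<times> nat" where
  "cell off v = (v mod 3, off + v div 3)"

lemma inj_cell: "inj (cell off)"
  by (auto simp: inj_def cell_def) (metis div_mult_mod_eq)

lemma inj_on_cell: "inj_on (cell off) X"
  by (rule inj_on_subset[OF inj_cell]) simp

text \<open>The closed neighbourhoods of the three columns taken alone. Ignoring edges that leave
  the block keeps different blocks disjoint.\<close>

definition block :: "nat \<Rightarrow> (nat \<times> nat) set set" where
  "block off = (`) (cell off) ` set ` set nbhds_3x3"

lemma wins_block: "wins 4 (block off)"
  unfolding block_def
  by (rule wins_image[OF infinite_UNIV_nat wins_nbhds_3x3 _ inj_on_cell]) simp

lemma block_subset: "\<Union>(block off) \<subseteq> {..<3} \<times> {off..<off + 3}"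
  by (auto simp: block_def nbhds_3x3_def cell_def)

text \<open>Containment instead of equality allows smaller sets than closed neighbourhoods, such as
  those of \<open>block\<close> or the rows of two columns.\<close>

definition covers :: "nat \<Rightarrow> (nat \<times> nat) set set \<Rightarrow> bool" where
  "covers n F \<longleftrightarrow> \<Union>F \<subseteq> pverts (grid n) \<and>
     (\<forall>v \<in> pverts (grid n). \<exists>A \<in> F. A \<subseteq> insert v {u. (v, u) \<in> parcs (grid n)})"

lemma covers_block:
  assumes "v \<in> {..<3} \<times> {n..<n + 3}"
  shows "\<exists>A \<in> block n. A \<subseteq> insert v {u. (v, u) \<in> parcs (grid (n + 3))}"
proof -
  obtain i j where v: "v = (i, n + j)" and "i < 3" "j < 3"
    using assms by (cases v) (auto simp: nat_le_iff_add)
  then consider "i = 0" "j = 0" | "i = 1" "j = 0" | "i = 2" "j = 0"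
    | "i = 0" "j = 1" | "i = 1" "j = 1" | "i = 2" "j = 1"
    | "i = 0" "j = 2" | "i = 1" "j = 2" | "i = 2" "j = 2"
    by (cases i; cases "i - 1"; cases j; cases "j - 1") auto
  then show ?thesis
    by cases (simp_all add: v block_def nbhds_3x3_def cell_def arc_grid_iff)
qed

text \<open>Appending columns only enlarges the neighbourhoods of old vertices, so their sets in
  \<open>F\<close> still fit.\<close>

lemma covers_add_block:
  assumes "covers n F"
  shows "covers (n + 3) (F \<union> block n)"
proof -
  have "\<exists>A \<in> F \<union> block n. A \<subseteq> insert v {u. (v, u) \<in> parcs (grid (n + 3))}"
    if v: "v \<in> pverts (grid (n + 3))" for v
  proof (cases "snd v < n")
    case True
    then have "v \<in> pverts (grid n)"
      using v by (auto simp: pverts_grid)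
    then obtain A where "A \<in> F" "A \<subseteq> insert v {u. (v, u) \<in> parcs (grid n)}"
      using assms by (auto simp: covers_def)
    moreover have "parcs (grid n) \<subseteq> parcs (grid (n + 3))"
      by (auto simp: arc_grid_iff)
    ultimately show ?thesis
      by blast
  next
    case False
    then have "v \<in> {..<3} \<times> {n..<n + 3}"
      using v by (cases v) (simp add: pverts_grid)
    then show ?thesis
      using covers_block by blast
  qed
  then show ?thesis
    using assms block_subset[of n] by (fastforce simp: covers_def pverts_grid)
qed

text \<open>\<open>r\<close> counts the moves after the opening \<open>d\<close>, when Staller is to
  move and positions can be added.\<close>

definition dominator_plan :: "nat \<Rightarrow> nat \<Rightarrow> bool" where
  "dominator_plan n r \<longleftrightarrow> (\<exists>F. covers n F \<and> (\<exists>d \<in> \<Union>F. wins r (dominator_move d F)))"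

text \<open>The opening lies in the old columns and leaves the new block untouched, so
  \<open>wins_Un\<close> adds its four moves.\<close>

lemma dominator_plan_add_block:
  assumes "dominator_plan n r"
  shows "dominator_plan (n + 3) (r + 4)"
proof -
  obtain F d where F: "covers n F" "d \<in> \<Union>F" "wins r (dominator_move d F)"
    using assms by (auto simp: dominator_plan_def)
  have sub: "\<Union>F \<subseteq> {..<3} \<times> {..<n}"
    using F(1) by (simp add: covers_def pverts_grid)
  then have disj: "\<Union>F \<inter> \<Union>(block n) = {}"
    using block_subset[of n] by fastforce
  then have "dominator_move d (F \<union> block n) = dominator_move d F \<union> block n"
    using F(2) dominator_move_id[of d "block n"] by (auto simp: dominator_move_Un)
  moreover have "\<Union>(dominator_move d F) \<inter> \<Union>(block n) = {}"
    using disj Union_dominator_move[of d F] by blast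
  ultimately have "wins (r + 4) (dominator_move d (F \<union> block n))"
    using wins_Un[OF F(3) wins_block] by simp
  then show ?thesis
    using covers_add_block[OF F(1)] F(2) unfolding dominator_plan_def by blast
qed

lemma dominator_plan_add_blocks:
  "dominator_plan n r \<Longrightarrow> dominator_plan (n + 3 * k) (r + 4 * k)"
proof (induction k)
  case (Suc k)
  then show ?case
    using dominator_plan_add_block[of "n + 3 * k" "r + 4 * k"] by (simp add: algebra_simps)
qed simp

lemma dominator_planI:
  assumes "covers n F" "wins q F" "q = Suc r" "F \<noteq> {}"
  shows "dominator_plan n r"
proof -
  have "finite (\<Union>F)"
    using assms(1) unfolding covers_def pverts_grid
    by (meson finite_SigmaI finite_lessThan finite_subset)
  then show ?thesis
    using wins_first_move[of r F] assms infinite_UNIV_nat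
    by (auto simp: dominator_plan_def finite_prod)
qed

lemma dominator_plan_1: "dominator_plan 1 0"
proof -
  \<comment> \<open>The centre lies in all three closed neighbourhoods of the column.\<close>
  let ?F = "{{(1, 0)}} :: (nat \<times> nat) set set"
  have "covers 1 ?F"
    by (auto simp: covers_def pverts_grid arc_grid_iff)
  moreover have "wins 0 (dominator_move (1, 0) ?F)"
    by (simp add: dominator_move_def)
  ultimately show ?thesis
    unfolding dominator_plan_def by blast
qed

lemma dominator_plan_2: "dominator_plan 2 2"
proof (rule dominator_planI)
  let ?F = "(`) (cell 0) ` set ` set [[0,3], [1,4], [2,5::nat]]"
  show "wins 3 ?F"
    by (rule wins_image[OF infinite_UNIV_nat wins_rows_3x2 _ inj_on_cell]) simp
  have "\<exists>A \<in> ?F. A \<subseteq> insert v {u. (v, u) \<in> parcs (grid 2)}" if v_in: "v \<in> {..<3} \<times> {..<2}" for v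
  proof -
    obtain i j where v: "v = (i, j)" and "i < 3" "j < 2"
      using v_in by (cases v) auto
    then consider "i = 0" "j = 0" | "i = 1" "j = 0" | "i = 2" "j = 0"
      | "i = 0" "j = 1" | "i = 1" "j = 1" | "i = 2" "j = 1"
      by (cases i; cases "i - 1"; cases j) auto
    then show ?thesis
      by cases (simp_all add: v cell_def arc_grid_iff)
  qed
  moreover have "\<Union>?F \<subseteq> {..<3} \<times> {..<2}"
    by (simp add: cell_def)
  ultimately show "covers 2 ?F"
    unfolding covers_def pverts_grid by blast
qed simp_all

lemma dominator_plan_3: "dominator_plan 3 3"
proof (rule dominator_planI)
  have "covers 0 {}"
    by (simp add: covers_def pverts_grid)
  then show "covers 3 (block 0)"
    using covers_add_block[of 0 "{}"] by simp
  show "wins 4 (block 0)"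
    by (rule wins_block)
  show "block 0 \<noteq> {}"
    by (simp add: block_def nbhds_3x3_def)
qed simp

lemma gamma_MB_grid_le:
  assumes "dominator_plan n r"
  shows "gamma_MB (grid n) \<le> enat (Suc r)"
  using assms gamma_MB_le[where G = "grid n"] unfolding dominator_plan_def covers_def by blast

theorem theorem3p5:
  fixes n :: nat
  assumes "n \<ge> 2"
  shows "ereal (of_int \<lfloor>(3 * real n + 4) / 4\<rfloor>) \<le> ereal_of_enat (gamma_MB (path_graph 3 \<box> path_graph n))
       \<and> ereal_of_enat (gamma_MB (path_graph 3 \<box> path_graph n)) \<le> ereal ((4 * real n + of_int (sigma_mod3 n)) / 3)"
proof
  \<comment> \<open>Rounding up \<open>(3 * n + 1) / 4\<close> is the same as rounding down
    \<open>(3 * n + 4) / 4\<close>.\<close>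
  have "(3 * n + 4) div 4 \<le> card D" if "dominating_set (grid n) D" for D
    using dominating_set_grid_card[OF that] assms by linarith
  then have "enat ((3 * n + 4) div 4) \<le> gamma_MB (grid n)"
    by (rule gamma_MB_ge)
  then have "ereal_of_enat (enat ((3 * n + 4) div 4)) \<le> ereal_of_enat (gamma_MB (grid n))"
    by (simp only: ereal_of_enat_le_iff)
  moreover have "\<lfloor>(3 * real n + 4) / 4\<rfloor> = int ((3 * n + 4) div 4)"
    using floor_divide_of_nat_eq[of "3 * n + 4" 4, where 'a = real] by simp
  ultimately show "ereal (of_int \<lfloor>(3 * real n + 4) / 4\<rfloor>) \<le> ereal_of_enat (gamma_MB (grid n))"
    by simp
next
  \<comment> \<open>The number of blocks after an initial one of one, two or three columns. The
    totals \<open>Suc r\<close> are \<open>4 * k + 1\<close>, \<open>4 * k + 3\<close> and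
    \<open>4 * k + 4\<close>; \<open>sigma_mod3\<close> merges them into one formula.\<close>
  define k where "k = (n - 1) div 3"
  consider "n = 1 + 3 * k" | "n = 2 + 3 * k" | "n = 3 + 3 * k"
    using assms unfolding k_def by linarith
  then obtain r where r: "dominator_plan n r" "real (Suc r) = (4 * real n + of_int (sigma_mod3 n)) / 3"
  proof cases
    case 1
    then show ?thesis
      using that[of "0 + 4 * k"] dominator_plan_add_blocks[OF dominator_plan_1, of k]
      by (simp add: sigma_mod3_def)
  next
    case 2
    moreover from 2 have "n mod 3 = 2"
      by presburger
    ultimately show ?thesis
      using that[of "2 + 4 * k"] dominator_plan_add_blocks[OF dominator_plan_2, of k]
      by (simp add: sigma_mod3_def)
  next
    case 3
    then show ?thesis
      using that[of "3 + 4 * k"] dominator_plan_add_blocks[OF dominator_plan_3, of k]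
      by (simp add: sigma_mod3_def)
  qed
  have "ereal_of_enat (gamma_MB (grid n)) \<le> ereal_of_enat (enat (Suc r))"
    using gamma_MB_grid_le[OF r(1)] by (simp only: ereal_of_enat_le_iff)
  then show "ereal_of_enat (gamma_MB (grid n)) \<le> ereal ((4 * real n + of_int (sigma_mod3 n)) / 3)"
    unfolding r(2)[symmetric] by simp
qed

end
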